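(* Let $\rho_1(x)=\frac{\pi}{2}\operatorname{sech}^2(\pi x)$ and for $\ell\ge2$ let $\rho_\ell(x)=\int_{-\infty}^\infty\rho_{\ell-1}(y)\rho_1(x-y)\,dy$. For a positive integer $\ell$ and $b>0$ set $$z_\ell(b)=\int_0^\infty\log(1+bu^2)\rho_\ell(u)\,du,$$ and for real $x\ne\ell/2$ set $y_\ell(x)=z_\ell\big((x-\ell/2)^{-2}\big)$. Then for every positive integer $\ell$ and every real $x\neq \ell/2$, $$\ell(\ell+1)y_{\ell+2}(x+1)=x(x-\ell)y_\ell''(x)+2(\ell+1)\left(x-\frac{\ell}{2}\right)y_\ell'(x)+\ell(\ell+1)y_\ell(x)+\frac{\ell^2}{4\left(x-\frac{\ell}{2}\right)^2}.$$ *)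

theory Defs
  imports "HOL-Analysis.Analysis"
begin

definition rho1 :: "real \<Rightarrow> real" where
  "rho1 x = pi / 2 * (1 / cosh (pi * x)) ^ 2"

text \<open>rho_l for l \<ge> 1 (rho 0 is an unused dummy value):
  rho_l(x) = integral over the real line of rho_(l-1)(y) rho_1(x - y) dy.\<close>
fun rho :: "nat \<Rightarrow> real \<Rightarrow> real" where
  "rho 0 x = 0"
| "rho (Suc 0) x = rho1 x"
| "rho (Suc (Suc n)) x = (LINT y|lborel. rho (Suc n) y * rho1 (x - y))"

definition z :: "nat \<Rightarrow> real \<Rightarrow> real" where
  "z l b = (LINT u:{0<..}|lborel. ln (1 + b * u ^ 2) * rho l u)"

definition y :: "nat \<Rightarrow> real \<Rightarrow> real" where
  "y l x = z l (1 / (x - real l / 2) ^ 2)"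

end

theory Submission
  imports Defs "HOL-Probability.Sinc_Integral" "HOL-Real_Asymp.Real_Asymp"
begin

text \<open>
  By the Gamma reflection formula, \<open>rho1\<close> has the characteristic function
  \<open>\<Gamma>(1 + i t / 2\<pi>) \<Gamma>(1 - i t / 2\<pi>) = (t / 2) / sinh (t / 2)\<close>, so that of \<open>rho l\<close> is its
  \<open>l\<close>-th power \<open>\<phi>\<close>. Put \<open>w = \<bar>x - l / 2\<bar>\<close>; the shift from \<open>(l, x)\<close> to \<open>(l + 2, x + 1)\<close> leaves \<open>w\<close>
  unchanged. A Frullani integral for \<open>ln (1 + u\<^sup>2 / w\<^sup>2)\<close> and Tonelli express \<open>y l x\<close> as the
  Laplace transform at \<open>w\<close> of \<open>(1 - \<phi>(t)) / t\<close>. A second-order differential equation linking the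
  \<open>l\<close>-th and \<open>(l + 2)\<close>-nd powers of \<open>(t / 2) / sinh (t / 2)\<close> then becomes the claim after
  integration by parts.
\<close>

section \<open>Gamma on the line of real part 1 and the logistic density\<close>

text \<open>Euler's integral under \<open>t = exp v\<close>: the Jacobian supplies
  \<open>exp v\<close>, and the power with exponent \<open>\<i> * a\<close> becomes the phase
  \<open>cis (a * v)\<close>. Gamma on this line is thus a Fourier transform.\<close>

lemma Gamma_exp_substitution:
  fixes a :: real
  shows "has_bochner_integral lborel (\<lambda>v. of_real (exp (v - exp v)) * cis (a * v)) (Gamma (Complex 1 a))"
proof -
  let ?f = "\<lambda>t. of_real t powr (Complex 1 a - 1) / of_real (exp t)"
  have "?f absolutely_integrable_on {0<..}"
    by (rule absolutely_integrable_Gamma_integral') simp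
  moreover have "integral {0<..} ?f = Gamma (Complex 1 a)"
    by (rule integral_unique, rule Gamma_integral_complex') simp
  moreover have range: "range (exp :: real \<Rightarrow> real) = {0<..}"
    by (auto simp: image_def) (metis exp_ln)
  ultimately have "(\<lambda>v. \<bar>exp v\<bar> *\<^sub>R ?f (exp v)) absolutely_integrable_on UNIV \<and>
      integral UNIV (\<lambda>v. \<bar>exp v\<bar> *\<^sub>R ?f (exp v)) = Gamma (Complex 1 a)"
    by (subst has_absolute_integral_change_of_variables_real[where g = exp])
       (auto intro: DERIV_exp simp: inj_on_def)
  moreover have "(\<lambda>v. \<bar>exp v\<bar> *\<^sub>R ?f (exp v)) = (\<lambda>v. of_real (exp (v - exp v)) * cis (a * v))"
  proof
    fix v :: real
    have "Complex 1 a - 1 = \<i> * of_real a" by (simp add: complex_eq_iff)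
    then have "of_real (exp v) powr (Complex 1 a - 1) = cis (a * v)"
      by (simp add: powr_def cis_conv_exp Ln_of_real mult_ac)
    then show "\<bar>exp v\<bar> *\<^sub>R ?f (exp v) = of_real (exp (v - exp v)) * cis (a * v)"
      by (simp add: scaleR_conv_of_real exp_diff)
  qed
  ultimately have *: "(\<lambda>v. of_real (exp (v - exp v)) * cis (a * v)) absolutely_integrable_on UNIV"
     "integral UNIV (\<lambda>v. of_real (exp (v - exp v)) * cis (a * v)) = Gamma (Complex 1 a)"
    by auto
  \<comment> \<open>The change of variables works over the completed measure; Borel measurability
    brings integrability back to \<open>lborel\<close>.\<close>
  have m: "(\<lambda>v. of_real (exp (v - exp v)) * cis (a * v)) \<in> borel_measurable lborel"
    unfolding cis_conv_exp by measurable
  have i: "integrable lborel (\<lambda>v. of_real (exp (v - exp v)) * cis (a * v))"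
    using *(1) m by (simp add: set_integrable_def integrable_completion)
  show ?thesis
    using i *(2) integral_lborel[OF i] by (simp add: has_bochner_integral_iff)
qed

text \<open>With \<open>s = exp v\<close> this is the integral of \<open>s * exp (- c * s)\<close>
  over the half-line. At \<open>c = 1 + exp r\<close> it evaluates the convolution in
  \<open>logistic_fourier\<close>.\<close>

lemma has_bochner_integral_exp_exp:
  fixes c :: real
  assumes "c > 0"
  shows "has_bochner_integral lborel (\<lambda>v. exp (2 * v - c * exp v)) (1 / c ^ 2)"
proof -
  let ?F = "\<lambda>v. - (exp v / c + 1 / c ^ 2) * exp (- c * exp v)"
  have A: "((?F \<circ> real_of_ereal) \<longlongrightarrow> - (1 / c\<^sup>2)) (at_right (-\<infinity>))"
    unfolding ereal_tendsto_simps using assms by real_asymp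
  have B: "((?F \<circ> real_of_ereal) \<longlongrightarrow> 0) (at_left \<infinity>)"
    unfolding ereal_tendsto_simps using assms by real_asymp
  have D: "(?F has_real_derivative exp (2 * v - c * exp v)) (at v)" for v
  proof -
    have "(?F has_real_derivative - (exp v / c) * exp (- c * exp v)
        + - (exp v / c + 1 / c ^ 2) * (exp (- c * exp v) * (- c * exp v))) (at v)"
      using assms by (auto intro!: derivative_eq_intros)
    also have "- (exp v / c) * exp (- c * exp v) + - (exp v / c + 1 / c ^ 2) * (exp (- c * exp v) * (- c * exp v))
        = exp v * exp v * exp (- c * exp v)"
      using assms by (simp add: field_simps power2_eq_square)
    also have "\<dots> = exp (2 * v - c * exp v)"
      by (simp flip: exp_add)
    finally show ?thesis .
  qed
  note FTC = interval_integral_FTC_nonneg[OF _ D _ _ A B]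
  have "set_integrable lborel (einterval (-\<infinity>) \<infinity>) (\<lambda>v. exp (2 * v - c * exp v))"
    by (rule FTC) auto
  moreover have "(LBINT v=-\<infinity>..\<infinity>. exp (2 * v - c * exp v)) = 0 - - (1 / c\<^sup>2)"
    by (rule FTC) auto
  ultimately show ?thesis
    by (simp add: has_bochner_integral_iff set_integrable_def interval_lebesgue_integral_def
        set_lebesgue_integral_def einterval_def)
qed

text \<open>Fubini and translation invariance. Applied to functions that already carry a phase, it
  says that the Fourier transform turns convolutions into products.\<close>

lemma has_bochner_integral_convolution:
  fixes f g :: "real \<Rightarrow> complex"
  assumes f: "integrable lborel f" and g: "integrable lborel g"
  shows "has_bochner_integral lborel (\<lambda>x. LINT y|lborel. f y * g (x - y))
    (integral\<^sup>L lborel f * integral\<^sup>L lborel g)"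
proof -
  define K where "K = (\<lambda>(y, x). f y * g (x - y))"
  have [measurable]: "f \<in> borel_measurable borel" "g \<in> borel_measurable borel"
    using assms by (auto dest: borel_measurable_integrable)
  have [measurable]: "K \<in> borel_measurable (lborel \<Otimes>\<^sub>M lborel)"
    unfolding K_def by measurable
  have g_shift: "integrable lborel (\<lambda>x. g (x - y))"
    "(LINT x|lborel. g (x - y)) = integral\<^sup>L lborel g"
    "(LINT x|lborel. norm (g (x - y))) = (LINT x|lborel. norm (g x))" for y
    using g lborel_integrable_real_affine[of g 1 "-y"] lborel_integral_real_affine[of 1 g "-y"]
      lborel_integral_real_affine[of 1 "\<lambda>x. norm (g x)" "-y"] by auto
  have int: "integrable (lborel \<Otimes>\<^sub>M lborel) K"
  proof (rule lborel_pair.Fubini_integrable)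
    show "integrable lborel (\<lambda>y. LINT x|lborel. norm (K (y, x)))"
      using f by (simp add: K_def norm_mult g_shift)
    show "AE y in lborel. integrable lborel (\<lambda>x. K (y, x))"
      using g_shift by (simp add: K_def)
  qed measurable
  have "(LINT x|lborel. LINT y|lborel. K (y, x)) = (LINT y|lborel. LINT x|lborel. K (y, x))"
    using lborel_pair.Fubini_integral[of "curry K"] int by simp
  also have "\<dots> = integral\<^sup>L lborel f * integral\<^sup>L lborel g"
    using g_shift by (simp add: K_def)
  finally show ?thesis
    using lborel_pair.integrable_snd[of "curry K"] int by (simp add: has_bochner_integral_iff K_def)
qed

text \<open>Substituting \<open>x = exp v\<close> in both Gamma integrals turns their product into the integral of a
  convolution that can be evaluated in closed form.\<close>

lemma logistic_fourier:
  fixes a :: real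
  shows "has_bochner_integral lborel (\<lambda>r. of_real (exp r / (1 + exp r) ^ 2) * cis (a * r))
    (Gamma (Complex 1 a) * Gamma (Complex 1 (- a)))"
proof -
  define f where "f b v = of_real (exp (v - exp v)) * cis (b * v)" for b v :: real
  have f: "has_bochner_integral lborel (f b) (Gamma (Complex 1 b))" for b
    using Gamma_exp_substitution[of b] unfolding f_def .
  \<comment> \<open>Reflecting one factor lets the double exponentials merge into
    \<open>exp (- (1 + exp r) * exp (- v))\<close>, while the phases combine to
    \<open>cis (a * r)\<close>, which is free of \<open>v\<close>.\<close>
  have f_refl: "has_bochner_integral lborel (\<lambda>v. f b (- v)) (Gamma (Complex 1 b))" for b
    using f[of b] lborel_has_bochner_integral_real_affine_iff[of "-1" "f b" _ 0] by simp
  have conv: "has_bochner_integral lborel (\<lambda>r. LINT v|lborel. f (- a) (- v) * f a (r - v))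
      (Gamma (Complex 1 (- a)) * Gamma (Complex 1 a))"
    using has_bochner_integral_convolution[of "\<lambda>v. f (- a) (- v)" "f a"] f[of a] f_refl[of "-a"]
    by (simp add: has_bochner_integral_iff)
  have "(LINT v|lborel. f (- a) (- v) * f a (r - v)) = of_real (exp r / (1 + exp r)\<^sup>2) * cis (a * r)" for r
  proof -
    have K: "f (- a) (- v) * f a (r - v) = 
        of_real (exp r) * cis (a * r) * of_real (exp (2 * (- v) - (1 + exp r) * exp (- v)))" for v
    proof -
      have c: "cis (a * v) * cis (a * (r - v)) = cis (a * r)"
        by (simp add: cis_mult algebra_simps)
      have e: "exp (- v - exp (- v)) * exp (r - v - exp (r - v)) = exp r * exp (2 * (- v) - (1 + exp r) * exp (- v))"
        by (simp add: exp_add[symmetric]) (simp add: algebra_simps exp_add[symmetric])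
      have "f (- a) (- v) * f a (r - v) = of_real (exp (- v - exp (- v)) * exp (r - v - exp (r - v))) * (cis (a * v) * cis (a * (r - v)))"
        by (simp add: f_def mult_ac)
      then show ?thesis unfolding c e by (simp add: mult_ac)
    qed
    have "has_bochner_integral lborel (\<lambda>v. exp (2 * v - (1 + exp r) * exp v)) (1 / (1 + exp r)\<^sup>2)"
      by (rule has_bochner_integral_exp_exp) (simp add: add_pos_pos)
    then have "(LINT v|lborel. exp (2 * (- v) - (1 + exp r) * exp (- v))) = 1 / (1 + exp r)\<^sup>2"
      using lborel_integral_real_affine[of "-1" "\<lambda>v. exp (2 * v - (1 + exp r) * exp v)" 0]
      by (simp add: has_bochner_integral_iff)
    then show ?thesis
      unfolding K integral_mult_right_zero integral_complex_of_real by (simp add: mult_ac)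
  qed
  then show ?thesis using conv by (simp add: mult.commute[of "Gamma (Complex 1 a)"])
qed

section \<open>The characteristic function of \<open>rho1\<close>\<close>

text \<open>The characteristic function of \<open>rho1\<close>; the value at 0 is the continuous
  extension.\<close>

definition sinhc_inv :: "real \<Rightarrow> real" where
  "sinhc_inv t = (if t = 0 then 1 else (t / 2) / sinh (t / 2))"

text \<open>For \<open>s = \<i> * t / (2 * pi)\<close>, the functional equation and the reflection
  formula give \<open>pi * s / sin (pi * s)\<close>, and the sine of an imaginary argument is
  \<open>\<i>\<close> times a hyperbolic sine.\<close>

lemma Gamma_1_plus_imaginary:
  fixes t :: real
  shows "Gamma (Complex 1 (t / (2 * pi))) * Gamma (Complex 1 (- (t / (2 * pi)))) = of_real (sinhc_inv t)"
proof (cases "t = 0")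
  case True
  have "Complex 1 0 = 1" by (simp add: complex_eq_iff)
  then show ?thesis using True by (simp add: sinhc_inv_def)
next
  case False
  define s where "s = \<i> * of_real (t / (2 * pi))"
  have s: "Complex 1 (t / (2 * pi)) = s + 1" "Complex 1 (- (t / (2 * pi))) = 1 - s"
    by (auto simp: s_def complex_eq_iff)
  have "s \<noteq> 0" using False by (simp add: s_def)
  have "s \<notin> \<int>\<^sub>\<le>\<^sub>0"
    using False by (auto simp: s_def nonpos_Ints_def complex_eq_iff)
  then have "Gamma (s + 1) = s * Gamma s" by (rule Gamma_plus1)
  then have "Gamma (s + 1) * Gamma (1 - s) = s * (of_real pi / sin (of_real pi * s))"
    using Gamma_reflection_complex[of s] by (simp add: mult.assoc)
  also have "of_real pi * s = \<i> * of_real (t / 2)"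
    by (simp add: s_def)
  also have "sin (\<i> * of_real (t / 2)) = \<i> * sinh (of_real (t / 2))"
    by (simp add: sinh_conv_sin)
  also have "sinh (complex_of_real (t / 2)) = of_real (sinh (t / 2))"
    by (simp add: sinh_field_def exp_of_real[symmetric])
  also have "s * (of_real pi / (\<i> * of_real (sinh (t / 2)))) = of_real (sinhc_inv t)"
    using False by (simp add: s_def sinhc_inv_def field_simps)
  finally show ?thesis by (simp add: s)
qed

lemma rho1_fourier:
  "has_bochner_integral lborel (\<lambda>u. of_real (rho1 u) * cis (t * u)) (of_real (sinhc_inv t))"
proof -
  \<comment> \<open>\<open>rho1\<close> is the logistic density of \<open>logistic_fourier\<close>
    compressed by the factor \<open>2 * pi\<close>, so the frequency there is
    \<open>t / (2 * pi)\<close>.\<close>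
  have *: "rho1 u = 2 * pi * (exp (2 * pi * u) / (1 + exp (2 * pi * u)) ^ 2)" for u
  proof -
    have e: "exp (2 * pi * u) = exp (pi * u) ^ 2" by (simp add: exp_double[symmetric] mult_ac)
    show ?thesis
      unfolding rho1_def e cosh_def exp_minus 
      by (simp add: field_simps power2_eq_square add_pos_pos add_nonneg_eq_0_iff)
  qed
  define f where "f r = of_real (exp r / (1 + exp r) ^ 2) * cis (t / (2 * pi) * r)" for r
  have "has_bochner_integral lborel f (of_real (sinhc_inv t))"
    using logistic_fourier[of "t / (2 * pi)"] unfolding Gamma_1_plus_imaginary f_def .
  then have "has_bochner_integral lborel (\<lambda>u. f (0 + 2 * pi * u)) (of_real (sinhc_inv t) /\<^sub>R \<bar>2 * pi\<bar>)"
    by (subst (asm) lborel_has_bochner_integral_real_affine_iff[of "2 * pi" _ _ 0]) auto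
  then have "has_bochner_integral lborel (\<lambda>u. of_real (2 * pi) * f (2 * pi * u))
      (of_real (2 * pi) * (of_real (sinhc_inv t) /\<^sub>R \<bar>2 * pi\<bar>))"
    by (intro has_bochner_integral_mult_right) auto
  moreover have "of_real (2 * pi) * f (2 * pi * u) = of_real (rho1 u) * cis (t * u)" for u
    unfolding * f_def by (simp add: mult.assoc)
  moreover have "of_real (2 * pi) * (of_real (sinhc_inv t) /\<^sub>R \<bar>2 * pi\<bar>) = complex_of_real (sinhc_inv t)"
    by (simp add: scaleR_conv_of_real)
  ultimately show ?thesis by simp
qed

section \<open>Characteristic functions of the iterated convolutions\<close>

lemma sinhc_inv_minus [simp]: "sinhc_inv (- t) = sinhc_inv t"
  by (simp add: sinhc_inv_def)

lemma sinhc_inv_0 [simp]: "sinhc_inv 0 = 1"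
  by (simp add: sinhc_inv_def)

lemma borel_measurable_sinhc_inv [measurable]: "sinhc_inv \<in> borel_measurable borel"
  unfolding sinhc_inv_def sinh_field_def by measurable

lemma rho_step: "n \<ge> 1 \<Longrightarrow> rho (Suc n) x = (LINT y|lborel. rho n y * rho1 (x - y))"
  by (cases n) auto

lemma borel_measurable_rho1 [measurable]: "rho1 \<in> borel_measurable borel"
  unfolding rho1_def cosh_field_def by measurable

text \<open>Each convolution contributes one factor \<open>sinhc_inv t\<close>: since
  \<open>cis (t * u) = cis (t * v) * cis (t * (u - v))\<close>, the phase distributes over the two
  convolved functions.\<close>

lemma rho_fourier:
  assumes "n \<ge> 1"
  shows "has_bochner_integral lborel (\<lambda>u. of_real (rho n u) * cis (t * u)) (of_real (sinhc_inv t ^ n))"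
  using assms
proof (induction n rule: nat_induct_at_least)
  case base
  then show ?case using rho1_fourier[of t] by simp
next
  case (Suc n)
  have *: "(of_real (rho n v) * cis (t * v)) * (of_real (rho1 (u - v)) * cis (t * (u - v)))
      = of_real (rho n v * rho1 (u - v)) * cis (t * u)" for u v
  proof -
    have "cis (t * v) * cis (t * (u - v)) = cis (t * u)"
      by (simp add: cis_mult algebra_simps)
    then show ?thesis by (simp add: mult_ac) 
  qed
  show ?case
    using has_bochner_integral_convolution[of "\<lambda>u. of_real (rho n u) * cis (t * u)" "\<lambda>u. of_real (rho1 u) * cis (t * u)"]
      Suc.IH rho1_fourier[of t]
    unfolding * integral_mult_left_zero integral_complex_of_real
    by (simp add: has_bochner_integral_iff rho_step[OF Suc.hyps] mult.commute)
qed

lemma rho_nonneg: "rho n x \<ge> 0"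
proof (induction n x rule: rho.induct)
  case (3 n x)
  then show ?case by (auto intro!: integral_nonneg_AE simp: rho1_def)
qed (auto simp: rho1_def)

text \<open>Evenness later folds an integral over the line onto the half-line in the definition of
  \<open>z\<close>.\<close>

lemma rho_minus: "rho n (- x) = rho n x"
proof (induction n x rule: rho.induct)
  case (3 n x)
  have rho1: "rho1 (- x - (- y)) = rho1 (x - y)" for y
  proof -
    have "pi * (- x - - y) = - (pi * (x - y))" by (simp add: algebra_simps)
    then show ?thesis unfolding rho1_def by (simp only: cosh_minus)
  qed
  have "rho (Suc (Suc n)) (- x) = (LINT y|lborel. rho (Suc n) (- y) * rho1 (- x - (- y)))"
    using lborel_integral_real_affine[of "-1" "\<lambda>y. rho (Suc n) y * rho1 (- x - y)" 0] by simp
  also have "\<dots> = rho (Suc (Suc n)) x"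
    unfolding rho1 by (simp add: 3)
  finally show ?case .
qed (auto simp: rho1_def)

lemma has_bochner_integral_cos_rho:
  assumes "n \<ge> 1"
  shows "has_bochner_integral lborel (\<lambda>u. cos (t * u) * rho n u) (sinhc_inv t ^ n)"
proof -
  have "has_bochner_integral lborel (\<lambda>u. Re (of_real (rho n u) * cis (t * u))) (Re (of_real (sinhc_inv t ^ n)))"
    by (rule has_bochner_integral_Re[OF rho_fourier[OF assms]])
  then show ?thesis by (simp add: mult.commute)
qed

text \<open>At frequency 0 the cosine is 1, so measurability can be read off from
  integrability.\<close>

lemma borel_measurable_rho [measurable]: "rho n \<in> borel_measurable borel"
proof (cases "n \<ge> 1")
  case True
  then show ?thesis
    using has_bochner_integral_cos_rho[OF True, of 0] by (auto simp: has_bochner_integral_iff dest: borel_measurable_integrable)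
next
  case False
  then have "rho n = (\<lambda>x. 0)" by (cases n) (auto simp: fun_eq_iff)
  then show ?thesis by simp
qed

text \<open>The lower bound combines \<open>1 - s / 2 \<le> exp (- (s / 2))\<close> with
  \<open>exp (- (s / 2)) * sinh (s / 2) = (1 - exp (- s)) / 2\<close>. It keeps the quotient
  \<open>(1 - sinhc_inv t ^ l) / t\<close> bounded near 0.\<close>

lemma sinhc_inv_bounds:
  shows "0 < sinhc_inv t" and "sinhc_inv t \<le> 1" and "1 - \<bar>t\<bar> / 2 \<le> sinhc_inv t"
proof -
  have *: "0 < sinhc_inv s \<and> sinhc_inv s \<le> 1 \<and> 1 - s / 2 \<le> sinhc_inv s" if "s > 0" for s
  proof -
    have "sinh (s / 2) \<ge> s / 2"
      using real_le_x_sinh[of "s / 2"] that by (simp add: sinh_field_def exp_minus)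
    moreover have "(1 - s / 2) * sinh (s / 2) \<le> s / 2"
    proof -
      have "exp (- (s / 2)) * sinh (s / 2) = (1 - exp (- s)) / 2"
        by (simp add: sinh_field_def algebra_simps exp_add[symmetric])
      also have "\<dots> \<le> s / 2" using exp_ge_add_one_self[of "- s"] by simp
      finally have "exp (- (s / 2)) * sinh (s / 2) \<le> s / 2" .
      moreover have "(1 - s / 2) * sinh (s / 2) \<le> exp (- (s / 2)) * sinh (s / 2)"
        using exp_ge_add_one_self[of "- (s / 2)"] that by (intro mult_right_mono) auto
      ultimately show ?thesis by linarith
    qed
    ultimately show ?thesis using that by (auto simp: sinhc_inv_def field_simps)
  qed
  show "0 < sinhc_inv t" "sinhc_inv t \<le> 1" "1 - \<bar>t\<bar> / 2 \<le> sinhc_inv t"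
    using *[of t] *[of "-t"] by (cases t "0 :: real" rule: linorder_cases; simp)+
qed

section \<open>A Frullani integral and the Laplace representation of \<open>z\<close>\<close>

lemma nn_integral_laplace_1_minus_cos:
  fixes u v :: real
  assumes "v > 0"
  shows "(\<integral>\<^sup>+t. ennreal (2 * (1 - cos (t * u)) * exp (- v * t)) * indicator {0..} t \<partial>lborel)
    = ennreal (2 / v - 2 * v / (v ^ 2 + u ^ 2))"
proof -
  \<comment> \<open>An antiderivative, built from the elementary ones of
    \<open>exp (- v * t)\<close> and \<open>exp (- v * t) * cos (t * u)\<close>; it is normalised to
    vanish at infinity.\<close>
  let ?F = "\<lambda>t. exp (- v * t) * (2 * (v * cos (t * u) - u * sin (t * u)) / (v ^ 2 + u ^ 2) - 2 / v)"
  have pos: "v\<^sup>2 + u\<^sup>2 > 0" using assms by (simp add: add_pos_nonneg)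
  have "(?F \<longlongrightarrow> 0) at_top"
  proof (rule Lim_null_comparison)
    show "\<forall>\<^sub>F t in at_top. norm (?F t) \<le> exp (- v * t) * (2 * (v + \<bar>u\<bar>) / (v ^ 2 + u ^ 2) + 2 / v)"
    proof (rule always_eventually, rule allI)
      fix t
      have "\<bar>v * cos (t * u)\<bar> \<le> v * 1" "\<bar>u * sin (t * u)\<bar> \<le> \<bar>u\<bar> * 1"
        unfolding abs_mult using assms by (intro mult_mono; simp)+
      then have "\<bar>v * cos (t * u) - u * sin (t * u)\<bar> \<le> v + \<bar>u\<bar>" by linarith
      then have "\<bar>2 * (v * cos (t * u) - u * sin (t * u)) / (v\<^sup>2 + u\<^sup>2)\<bar> \<le> 2 * (v + \<bar>u\<bar>) / (v\<^sup>2 + u\<^sup>2)"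
        using pos by (simp add: abs_mult divide_right_mono)
      moreover have "\<bar>2 / v\<bar> = 2 / v" using assms by simp
      ultimately have "\<bar>2 * (v * cos (t * u) - u * sin (t * u)) / (v\<^sup>2 + u\<^sup>2) - 2 / v\<bar> \<le> 2 * (v + \<bar>u\<bar>) / (v\<^sup>2 + u\<^sup>2) + 2 / v"
        by linarith
      then show "norm (?F t) \<le> exp (- v * t) * (2 * (v + \<bar>u\<bar>) / (v ^ 2 + u ^ 2) + 2 / v)"
        by (simp add: abs_mult)
    qed
    show "((\<lambda>t. exp (- v * t) * (2 * (v + \<bar>u\<bar>) / (v ^ 2 + u ^ 2) + 2 / v)) \<longlongrightarrow> 0) at_top"
      by (rule tendsto_mult_left_zero) (use assms in real_asymp)
  qed
  moreover have "(?F has_real_derivative 2 * (1 - cos (t * u)) * exp (- v * t)) (at t)" for t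
  proof -
    have "(?F has_real_derivative (exp (- v * t) * (- v) * (2 * (v * cos (t * u) - u * sin (t * u)) / (v ^ 2 + u ^ 2) - 2 / v)
        + exp (- v * t) * (2 * (v * (- sin (t * u) * u) - u * (cos (t * u) * u)) / (v ^ 2 + u ^ 2)))) (at t)"
      using pos by (auto intro!: derivative_eq_intros)
    also have "(exp (- v * t) * (- v) * (2 * (v * cos (t * u) - u * sin (t * u)) / (v ^ 2 + u ^ 2) - 2 / v)
        + exp (- v * t) * (2 * (v * (- sin (t * u) * u) - u * (cos (t * u) * u)) / (v ^ 2 + u ^ 2)))
      = 2 * (1 - cos (t * u)) * exp (- v * t)"
      using pos assms by (simp add: divide_simps) (simp add: algebra_simps power2_eq_square)
    finally show ?thesis .
  qed
  ultimately have "(\<integral>\<^sup>+t. ennreal (2 * (1 - cos (t * u)) * exp (- v * t)) * indicator {0..} t \<partial>lborel) = ennreal (0 - ?F 0)"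
    by (intro nn_integral_FTC_atLeast) auto
  then show ?thesis by simp
qed

text \<open>Write \<open>exp (- w * t) / t\<close> as the integral of \<open>exp (- v * t)\<close>
  over \<open>v \<ge> w\<close> and exchange the integrals by Tonelli. The inner one is then the
  derivative of \<open>- ln (1 + u ^ 2 / v ^ 2)\<close> in \<open>v\<close>.\<close>

lemma frullani_cos:
  fixes u w :: real
  assumes "w > 0"
  shows "(\<integral>\<^sup>+t. ennreal (2 * (1 - cos (t * u)) / t * exp (- w * t)) * indicator {0..} t \<partial>lborel)
    = ennreal (ln (1 + u ^ 2 / w ^ 2))"
proof -
  have "(\<integral>\<^sup>+t. ennreal (2 * (1 - cos (t * u)) / t * exp (- w * t)) * indicator {0..} t \<partial>lborel) =
     (\<integral>\<^sup>+t. \<integral>\<^sup>+v. ennreal (2 * (1 - cos (t * u)) * exp (- v * t)) * indicator {0..} t * indicator {w..} v \<partial>lborel \<partial>lborel)"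
  proof (rule nn_integral_cong)
    fix t :: real
    show "ennreal (2 * (1 - cos (t * u)) / t * exp (- w * t)) * indicator {0..} t =
      (\<integral>\<^sup>+v. ennreal (2 * (1 - cos (t * u)) * exp (- v * t)) * indicator {0..} t * indicator {w..} v \<partial>lborel)"
    proof (cases "t > 0")
      case True
      let ?F = "\<lambda>v. - (2 * (1 - cos (t * u)) / t) * exp (- v * t)"
      have "(\<integral>\<^sup>+v. ennreal (2 * (1 - cos (t * u)) * exp (- v * t)) * indicator {w..} v \<partial>lborel) = ennreal (0 - ?F w)"
      proof (rule nn_integral_FTC_atLeast)
        show "(?F \<longlongrightarrow> 0) at_top"
          by (rule tendsto_mult_right_zero) (use True in real_asymp)
        show "(?F has_real_derivative 2 * (1 - cos (t * u)) * exp (- v * t)) (at v)" for v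
          using True by (auto intro!: derivative_eq_intros)
      qed auto
      then show ?thesis using True by simp
    next
      case False
      \<comment> \<open>At \<open>t = 0\<close> both sides vanish because
        \<open>1 - cos 0 = 0\<close>; for negative \<open>t\<close> the indicator does.\<close>
      then show ?thesis by (cases "t = 0") auto
    qed
  qed
  also have "\<dots> = (\<integral>\<^sup>+v. \<integral>\<^sup>+t. ennreal (2 * (1 - cos (t * u)) * exp (- v * t)) * indicator {0..} t * indicator {w..} v \<partial>lborel \<partial>lborel)"
    by (rule lborel_pair.Fubini') measurable
  also have "\<dots> = (\<integral>\<^sup>+v. ennreal (2 / v - 2 * v / (v ^ 2 + u ^ 2)) * indicator {w..} v \<partial>lborel)"
  proof (rule nn_integral_cong)
    fix v :: real
    show "(\<integral>\<^sup>+t. ennreal (2 * (1 - cos (t * u)) * exp (- v * t)) * indicator {0..} t * indicator {w..} v \<partial>lborel)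
      = ennreal (2 / v - 2 * v / (v ^ 2 + u ^ 2)) * indicator {w..} v"
      using nn_integral_laplace_1_minus_cos[of v u] assms
      by (cases "w \<le> v") (auto simp: nn_integral_multc)
  qed
  also have "\<dots> = ennreal (0 - - ln (1 + u ^ 2 / w ^ 2))"
  proof (rule nn_integral_FTC_atLeast)
    show "((\<lambda>v. - ln (1 + u ^ 2 / v ^ 2)) \<longlongrightarrow> 0) at_top" by real_asymp
    fix v assume "w \<le> v"
    then have v: "v > 0" using assms by simp
    then have pos: "v\<^sup>2 + u\<^sup>2 > 0" by (simp add: add_pos_nonneg)
    have pos': "1 + u\<^sup>2 / v\<^sup>2 > 0" using v by (simp add: add_pos_nonneg)
    have "((\<lambda>v. - ln (1 + u ^ 2 / v ^ 2)) has_real_derivative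
        - ((u\<^sup>2 * - (2 * v)) / (v ^ 2 * v ^ 2) / (1 + u\<^sup>2 / v\<^sup>2))) (at v)"
      using v pos' by (auto intro!: derivative_eq_intros)
    also have "- ((u\<^sup>2 * - (2 * v)) / (v ^ 2 * v ^ 2) / (1 + u\<^sup>2 / v\<^sup>2)) = 2 / v - 2 * v / (v ^ 2 + u ^ 2)"
      using v pos pos' by (simp add: divide_simps) (simp add: algebra_simps power2_eq_square power4_eq_xxxx)
    finally show "((\<lambda>v. - ln (1 + u ^ 2 / v ^ 2)) has_real_derivative 2 / v - 2 * v / (v ^ 2 + u ^ 2)) (at v)" .
    show "0 \<le> 2 / v - 2 * v / (v ^ 2 + u ^ 2)"
      using v pos by (simp add: divide_simps) (simp add: algebra_simps power2_eq_square)
  qed auto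
  finally show ?thesis by simp
qed

text \<open>Insert \<open>frullani_cos\<close> for the logarithm and apply Tonelli; the integral
  over \<open>u\<close> yields \<open>1 - sinhc_inv t ^ l\<close>. The factor 2 from Frullani
  cancels the one from extending \<open>z\<close> to the whole line. All comparisons take place in
  \<open>ennreal\<close>, where nonnegativity suffices.\<close>

lemma z_laplace:
  assumes "l \<ge> 1" and "w > 0"
  shows "z l (1 / w ^ 2) = (LINT t:{0<..}|lborel. (1 - sinhc_inv t ^ l) / t * exp (- w * t))"
proof -
  let ?L = "\<lambda>u. ln (1 + u ^ 2 / w ^ 2)"
  let ?h = "\<lambda>t. (1 - sinhc_inv t ^ l) / t * exp (- w * t)"
  have L_nonneg: "?L u \<ge> 0" for u using assms by (intro ln_ge_zero) auto
  have g_nonneg: "1 - sinhc_inv t ^ l \<ge> 0" for t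
    using sinhc_inv_bounds[of t] by (simp add: power_le_one)
  define N where "N = (\<integral>\<^sup>+u. ennreal (?L u * rho l u) \<partial>lborel)"
  have "N = (\<integral>\<^sup>+u. \<integral>\<^sup>+t. ennreal (2 * (1 - cos (t * u)) / t * exp (- w * t)) * indicator {0..} t * ennreal (rho l u) \<partial>lborel \<partial>lborel)"
    unfolding N_def
  proof (rule nn_integral_cong)
    fix u
    have "ennreal (?L u * rho l u) = ennreal (?L u) * ennreal (rho l u)"
      by (simp add: ennreal_mult L_nonneg rho_nonneg)
    also have "ennreal (?L u) = (\<integral>\<^sup>+t. ennreal (2 * (1 - cos (t * u)) / t * exp (- w * t)) * indicator {0..} t \<partial>lborel)"
      using frullani_cos[OF assms(2)] by simp
    also have "\<dots> * ennreal (rho l u) = (\<integral>\<^sup>+t. ennreal (2 * (1 - cos (t * u)) / t * exp (- w * t)) * indicator {0..} t * ennreal (rho l u) \<partial>lborel)"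
      by (rule nn_integral_multc[symmetric]) measurable
    finally show "ennreal (?L u * rho l u) = (\<integral>\<^sup>+t. ennreal (2 * (1 - cos (t * u)) / t * exp (- w * t)) * indicator {0..} t * ennreal (rho l u) \<partial>lborel)" .
  qed
  also have "\<dots> = (\<integral>\<^sup>+t. \<integral>\<^sup>+u. ennreal (2 * (1 - cos (t * u)) / t * exp (- w * t)) * indicator {0..} t * ennreal (rho l u) \<partial>lborel \<partial>lborel)"
    by (rule lborel_pair.Fubini') measurable
  also have "\<dots> = (\<integral>\<^sup>+t. 2 * (ennreal (?h t) * indicator {0<..} t) \<partial>lborel)"
  proof (rule nn_integral_cong)
    fix t :: real
    show "(\<integral>\<^sup>+u. ennreal (2 * (1 - cos (t * u)) / t * exp (- w * t)) * indicator {0..} t * ennreal (rho l u) \<partial>lborel)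
      = 2 * (ennreal (?h t) * indicator {0<..} t)"
    proof (cases "t > 0")
      case True
      \<comment> \<open>The constant 1 is written as \<open>cos (0 * u)\<close>, so that the total
        mass of \<open>rho l\<close> is its characteristic function at 0.\<close>
      have "has_bochner_integral lborel (\<lambda>u. cos (0 * u) * rho l u - cos (t * u) * rho l u) (sinhc_inv 0 ^ l - sinhc_inv t ^ l)"
        by (intro has_bochner_integral_diff has_bochner_integral_cos_rho assms)
      then have hb: "has_bochner_integral lborel (\<lambda>u. (1 - cos (t * u)) * rho l u) (1 - sinhc_inv t ^ l)"
        by (simp add: left_diff_distrib)
      have "(\<integral>\<^sup>+u. ennreal (2 * (1 - cos (t * u)) / t * exp (- w * t)) * indicator {0..} t * ennreal (rho l u) \<partial>lborel)
        = (\<integral>\<^sup>+u. ennreal (2 / t * exp (- w * t)) * ennreal ((1 - cos (t * u)) * rho l u) \<partial>lborel)"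
        using True by (intro nn_integral_cong) (simp add: ennreal_mult[symmetric] rho_nonneg mult_ac)
      also have "\<dots> = ennreal (2 / t * exp (- w * t)) * ennreal (1 - sinhc_inv t ^ l)"
        using hb by (simp add: nn_integral_cmult nn_integral_eq_integral has_bochner_integral_iff rho_nonneg)
      also have "\<dots> = ennreal (2 * ?h t)"
        using True g_nonneg[of t] by (simp add: ennreal_mult[symmetric] mult_ac)
      also have "\<dots> = 2 * (ennreal (?h t) * indicator {0<..} t)"
        using True g_nonneg[of t] ennreal_mult[of 2 "?h t"] by simp
      finally show ?thesis .
    next
      case False
      then show ?thesis by (cases "t = 0") auto
    qed
  qed
  finally have N1: "N = 2 * (\<integral>\<^sup>+t. ennreal (?h t) * indicator {0<..} t \<partial>lborel)"
    by (simp add: nn_integral_cmult)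
  let ?A = "\<integral>\<^sup>+u. ennreal (?L u * rho l u) * indicator {0<..} u \<partial>lborel"
  \<comment> \<open>The point \<open>u = 0\<close> may be dropped since the logarithm vanishes
    there; the negative half equals the positive one by evenness.\<close>
  have "N = (\<integral>\<^sup>+u. ennreal (?L u * rho l u) * indicator {0<..} u + ennreal (?L u * rho l u) * indicator {..<0} u \<partial>lborel)"
    unfolding N_def by (intro nn_integral_cong) (auto simp: indicator_def)
  also have "\<dots> = ?A + (\<integral>\<^sup>+u. ennreal (?L u * rho l u) * indicator {..<0} u \<partial>lborel)"
    by (rule nn_integral_add) measurable
  also have "(\<integral>\<^sup>+u. ennreal (?L u * rho l u) * indicator {..<0} u \<partial>lborel) = ?A"
    by (subst nn_integral_real_affine[of _ "-1" 0]) (auto simp: rho_minus indicator_def intro!: nn_integral_cong)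
  finally have N2: "N = 2 * ?A" by (simp add: mult_2)
  have "?A = (\<integral>\<^sup>+t. ennreal (?h t) * indicator {0<..} t \<partial>lborel)"
    using N1 N2 by (simp add: ennreal_mult_cancel_left)
  moreover have "z l (1 / w ^ 2) = enn2real ?A"
    unfolding z_def set_lebesgue_integral_def
    by (subst integral_eq_nn_integral) 
       (auto simp: indicator_def rho_nonneg L_nonneg intro!: arg_cong[where f = enn2real] nn_integral_cong)
  moreover have "(LINT t:{0<..}|lborel. ?h t) = enn2real (\<integral>\<^sup>+t. ennreal (?h t) * indicator {0<..} t \<partial>lborel)"
    unfolding set_lebesgue_integral_def
    by (subst integral_eq_nn_integral)
       (use g_nonneg in \<open>auto simp: indicator_def intro!: divide_nonneg_pos arg_cong[where f = enn2real] nn_integral_cong AE_I2\<close>)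
  ultimately show ?thesis by simp
qed

section \<open>Laplace transforms and differentiation under the integral sign\<close>

definition laplace :: "(real \<Rightarrow> real) \<Rightarrow> real \<Rightarrow> real" where
  "laplace g w = (LINT t:{0<..}|lborel. g t * exp (- w * t))"

text \<open>The Gamma integral rescaled by \<open>w\<close>. It supplies the dominating functions
  below and, for \<open>k = 1\<close>, the inhomogeneous term of the recurrence.\<close>

lemma has_bochner_integral_laplace_power:
  fixes w :: real
  assumes "w > 0"
  shows "has_bochner_integral lborel (\<lambda>t. indicator {0<..} t *\<^sub>R (t ^ k * exp (- w * t))) (fact k / w ^ Suc k)"
proof -
  have "has_bochner_integral lborel (\<lambda>t. (0 + w * t) ^ k * exp (- (0 + w * t)) * indicator {0<..} (0 + w * t)) (fact k /\<^sub>R \<bar>w\<bar>)"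
    using has_bochner_integral_I0i_power_exp_m[of k] assms
    by (subst (asm) lborel_has_bochner_integral_real_affine_iff[of w _ _ 0]) auto
  then have "has_bochner_integral lborel (\<lambda>t. (1 / w ^ k) * ((0 + w * t) ^ k * exp (- (0 + w * t)) * indicator {0<..} (0 + w * t)))
     ((1 / w ^ k) * (fact k /\<^sub>R \<bar>w\<bar>))"
    by (intro has_bochner_integral_mult_right) auto
  moreover have "(1 / w ^ k) * ((0 + w * t) ^ k * exp (- (0 + w * t)) * indicator {0<..} (0 + w * t))
      = indicator {0<..} t *\<^sub>R (t ^ k * exp (- w * t))" for t
    using assms by (auto simp: indicator_def power_mult_distrib zero_less_mult_iff)
  moreover have "(1 / w ^ k) * (fact k /\<^sub>R \<bar>w\<bar>) = fact k / w ^ Suc k"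
    using assms by (simp add: field_simps)
  ultimately show ?thesis by simp
qed

lemma has_bochner_integral_laplace:
  fixes g :: "real \<Rightarrow> real"
  assumes [measurable]: "g \<in> borel_measurable borel"
    and bound: "\<And>t. t > 0 \<Longrightarrow> \<bar>g t\<bar> \<le> B * t ^ k"
    and "w > 0"
  shows "has_bochner_integral lborel (\<lambda>t. indicator {0<..} t *\<^sub>R (g t * exp (- w * t))) (laplace g w)"
proof -
  have "integrable lborel (\<lambda>t. B * (indicator {0<..} t *\<^sub>R (t ^ k * exp (- w * t))))"
    using has_bochner_integral_laplace_power[OF assms(3), of k] by (simp add: has_bochner_integral_iff)
  then have "integrable lborel (\<lambda>t. indicator {0<..} t *\<^sub>R (g t * exp (- w * t)))"
  proof (rule Bochner_Integration.integrable_bound)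
    show "AE t in lborel. norm (indicator {0<..} t *\<^sub>R (g t * exp (- w * t)))
        \<le> norm (B * (indicator {0<..} t *\<^sub>R (t ^ k * exp (- w * t))))"
    proof (rule AE_I2)
      fix t :: real
      have "\<bar>g t\<bar> * exp (- w * t) \<le> \<bar>B * t ^ k\<bar> * exp (- w * t)" if "t > 0"
        using bound[OF that] by (intro mult_right_mono) auto
      then show "norm (indicator {0<..} t *\<^sub>R (g t * exp (- w * t)))
        \<le> norm (B * (indicator {0<..} t *\<^sub>R (t ^ k * exp (- w * t))))"
        by (auto simp: indicator_def abs_mult mult_ac)
    qed
  qed measurable
  then show ?thesis
    by (simp add: has_bochner_integral_iff laplace_def set_lebesgue_integral_def)
qed

text \<open>Dominated convergence for the difference quotients along sequences tending to
  \<open>w\<close>; the mean value inequality bounds each quotient of exponentials by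
  \<open>t * exp (- (w / 2) * t)\<close>.\<close>

lemma laplace_char_defectas_derivative:
  fixes g :: "real \<Rightarrow> real"
  assumes [measurable]: "g \<in> borel_measurable borel"
    and bound: "\<And>t. t > 0 \<Longrightarrow> \<bar>g t\<bar> \<le> B * t ^ k"
    and "w > 0"
  shows "(laplace g has_real_derivative laplace (\<lambda>t. - (t * g t)) w) (at w)"
proof -
  \<comment> \<open>Staying above \<open>w / 2\<close> gives one exponential decay rate for all
    quotients; \<open>S\<close> is an open neighbourhood of \<open>w\<close>, so the limit within it
    is the full limit.\<close>
  define S where "S = {w / 2<..}"
  define q where "q = (\<lambda>v t. indicator {0<..} t *\<^sub>R (g t * ((exp (- v * t) - exp (- w * t)) / (v - w))))"
  have quot: "(laplace g v - laplace g w) / (v - w) = integral\<^sup>L lborel (q v)" if "v > 0" for v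
  proof -
    have "has_bochner_integral lborel (\<lambda>t. (indicator {0<..} t *\<^sub>R (g t * exp (- v * t)) - indicator {0<..} t *\<^sub>R (g t * exp (- w * t))) / (v - w))
       ((laplace g v - laplace g w) / (v - w))"
      using assms that by (intro has_bochner_integral_divide_zero has_bochner_integral_diff has_bochner_integral_laplace) auto
    also have "(\<lambda>t. (indicator {0<..} t *\<^sub>R (g t * exp (- v * t)) - indicator {0<..} t *\<^sub>R (g t * exp (- w * t))) / (v - w)) = q v"
      by (auto simp: q_def indicator_def algebra_simps diff_divide_distrib)
    finally show ?thesis by (simp add: has_bochner_integral_iff)
  qed
  have "((\<lambda>v. (laplace g v - laplace g w) / (v - w)) \<longlongrightarrow> laplace (\<lambda>t. - (t * g t)) w) (at w within S)"
    unfolding tendsto_at_iff_sequentially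
  proof (intro allI impI)
    fix X assume X: "\<forall>i. X i \<in> S - {w}" "X \<longlonglongrightarrow> w"
    have Xpos: "X i > w / 2" "X i > 0" "X i \<noteq> w" for i
      using X(1)[rule_format, of i] assms(3) by (auto simp: S_def)
    have "(\<lambda>i. integral\<^sup>L lborel (q (X i))) \<longlonglongrightarrow> (LINT t|lborel. indicator {0<..} t *\<^sub>R (- (t * g t) * exp (- w * t)))"
    proof (rule integral_dominated_convergence)
      show "integrable lborel (\<lambda>t. B * (indicator {0<..} t *\<^sub>R (t ^ Suc k * exp (- (w / 2) * t))))"
        using has_bochner_integral_laplace_power[of "w / 2" "Suc k"] assms(3) by (simp add: has_bochner_integral_iff)
      show "(\<lambda>t. indicator {0<..} t *\<^sub>R (- (t * g t) * exp (- w * t))) \<in> borel_measurable lborel" by measurable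
      show "q (X i) \<in> borel_measurable lborel" for i unfolding q_def by measurable
      show "AE t in lborel. (\<lambda>i. q (X i) t) \<longlonglongrightarrow> indicator {0<..} t *\<^sub>R (- (t * g t) * exp (- w * t))"
      proof (rule AE_I2)
        fix t :: real
        have "((\<lambda>v. exp (- v * t)) has_real_derivative exp (- w * t) * (- t)) (at w)"
          by (auto intro!: derivative_eq_intros)
        then have "((\<lambda>v. (exp (- v * t) - exp (- w * t)) / (v - w)) \<longlongrightarrow> exp (- w * t) * (- t)) (at w)"
          by (simp add: has_field_derivative_iff)
        then have "(\<lambda>i. (exp (- X i * t) - exp (- w * t)) / (X i - w)) \<longlonglongrightarrow> exp (- w * t) * (- t)"
          using X Xpos unfolding tendsto_at_iff_sequentially comp_def by auto
        then have "(\<lambda>i. indicator {0<..} t *\<^sub>R (g t * ((exp (- X i * t) - exp (- w * t)) / (X i - w))))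
           \<longlonglongrightarrow> indicator {0<..} t *\<^sub>R (g t * (exp (- w * t) * (- t)))"
          by (intro tendsto_intros)
        then show "(\<lambda>i. q (X i) t) \<longlonglongrightarrow> indicator {0<..} t *\<^sub>R (- (t * g t) * exp (- w * t))"
          unfolding q_def by (simp add: mult_ac)
      qed
      show "AE t in lborel. norm (q (X i) t) \<le> B * (indicator {0<..} t *\<^sub>R (t ^ Suc k * exp (- (w / 2) * t)))" for i
      proof (rule AE_I2)
        fix t :: real
        show "norm (q (X i) t) \<le> B * (indicator {0<..} t *\<^sub>R (t ^ Suc k * exp (- (w / 2) * t)))"
        proof (cases "t > 0")
          case True
          have "norm (exp (- X i * t) - exp (- w * t)) \<le> (t * exp (- (w / 2) * t)) * norm (X i - w)"
          proof (rule field_differentiable_bound[where S = S and f' = "\<lambda>v. - t * exp (- v * t)"])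
            show "convex S" unfolding S_def by simp
            show "((\<lambda>v. exp (- v * t)) has_field_derivative - t * exp (- v * t)) (at v within S)" for v
              by (auto intro!: derivative_eq_intros)
            show "norm (- t * exp (- v * t)) \<le> t * exp (- (w / 2) * t)" if "v \<in> S" for v
              using that True by (auto simp: S_def abs_mult)
            show "X i \<in> S" "w \<in> S" using Xpos assms(3) by (auto simp: S_def)
          qed
          then have "\<bar>(exp (- X i * t) - exp (- w * t)) / (X i - w)\<bar> \<le> t * exp (- (w / 2) * t)"
            using Xpos(3)[of i] by (simp add: divide_simps)
          then have "\<bar>g t\<bar> * \<bar>(exp (- X i * t) - exp (- w * t)) / (X i - w)\<bar> \<le> (B * t ^ k) * (t * exp (- (w / 2) * t))"
            using bound[OF True] by (intro mult_mono) auto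
          then show ?thesis using True by (simp add: q_def abs_mult mult_ac)
        next
          case False
          then show ?thesis by (simp add: q_def)
        qed
      qed
    qed
    then show "((\<lambda>v. (laplace g v - laplace g w) / (v - w)) \<circ> X) \<longlonglongrightarrow> laplace (\<lambda>t. - (t * g t)) w"
      using quot Xpos(2) by (simp add: comp_def laplace_def set_lebesgue_integral_def)
  qed
  moreover have "at w within S = at w"
    using assms(3) by (intro at_within_open) (auto simp: S_def)
  ultimately show ?thesis by (simp add: has_field_derivative_iff)
qed

section \<open>Differential identities for \<open>sinhc_inv\<close>\<close>

text \<open>\<open>t\<close> times the logarithmic derivative of \<^const>\<open>sinhc_inv\<close>.\<close>

definition sinhc_inv_ldiff :: "real \<Rightarrow> real" where
  "sinhc_inv_ldiff t = 1 - t / 2 * cosh (t / 2) / sinh (t / 2)"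

lemma DERIV_sinhc_inv:
  assumes "t > 0"
  shows "(sinhc_inv has_real_derivative sinhc_inv t * sinhc_inv_ldiff t / t) (at t)"
proof -
  have "((\<lambda>t. (t / 2) / sinh (t / 2)) has_real_derivative
      (1 / 2 * sinh (t / 2) - t / 2 * (cosh (t / 2) * (1 / 2))) / (sinh (t / 2) * sinh (t / 2))) (at t)"
    using assms by (auto intro!: derivative_eq_intros simp: field_simps)
  also have "(1 / 2 * sinh (t / 2) - t / 2 * (cosh (t / 2) * (1 / 2))) / (sinh (t / 2) * sinh (t / 2))
     = sinhc_inv t * sinhc_inv_ldiff t / t"
    using assms by (simp add: sinhc_inv_def sinhc_inv_ldiff_def field_simps)
  finally show ?thesis
    by (rule has_field_derivative_transform_within_open[where S = "{0<..}"])
       (use assms in \<open>auto simp: sinhc_inv_def\<close>)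
qed

text \<open>A Riccati equation: derivatives of powers of \<open>sinhc_inv\<close> stay polynomial in
  \<open>sinhc_inv_ldiff\<close>, up to powers of \<open>t\<close>.\<close>

lemma DERIV_sinhc_inv_ldiff:
  assumes "t > 0"
  shows "(sinhc_inv_ldiff has_real_derivative - (sinhc_inv_ldiff t * (1 - sinhc_inv_ldiff t)) / t - t / 4) (at t)"
proof -
  define S C where "S = sinh (t / 2)" and "C = cosh (t / 2)"
  have "S \<noteq> 0" and CS: "C * C = S * S + 1"
    using assms cosh_square_eq[of "t / 2"] by (auto simp: S_def C_def power2_eq_square)
  have "(sinhc_inv_ldiff has_real_derivative - (((1 / 2 * C + t / 2 * (S * (1 / 2))) * S - t / 2 * C * (C * (1 / 2))) / (S * S))) (at t)"
    unfolding sinhc_inv_ldiff_def[abs_def] S_def C_def using assms by (auto intro!: derivative_eq_intros simp: field_simps)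
  also have "- (((1 / 2 * C + t / 2 * (S * (1 / 2))) * S - t / 2 * C * (C * (1 / 2))) / (S * S))
    = - (sinhc_inv_ldiff t * (1 - sinhc_inv_ldiff t)) / t - t / 4"
    unfolding sinhc_inv_ldiff_def S_def[symmetric] C_def[symmetric] using assms \<open>S \<noteq> 0\<close>
    by (simp add: field_simps)
  finally show ?thesis .
qed

text \<open>Since \<open>1 - sinhc_inv_ldiff t\<close> is \<open>t / 2\<close> times the hyperbolic
  cotangent, this is \<open>cosh^2 - 1 = sinh^2\<close>. It relates the power \<open>l + 2\<close>
  to the power \<open>l\<close>.\<close>

lemma sinhc_inv_square:
  assumes "t > 0"
  shows "sinhc_inv t ^ 2 = (1 - sinhc_inv_ldiff t) ^ 2 - t ^ 2 / 4"
proof -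
  have "sinh (t / 2) \<noteq> 0" using assms by simp
  then show ?thesis using assms
    unfolding sinhc_inv_def sinhc_inv_ldiff_def power_divide power_mult_distrib by (simp add: power_divide power_mult_distrib cosh_square_eq field_simps)
qed

lemma sinhc_inv_at_right_0: "(sinhc_inv \<longlongrightarrow> 1) (at_right 0)"
proof (rule Lim_transform_eventually)
  show "((\<lambda>t. (t / 2) / sinh (t / 2)) \<longlongrightarrow> (1::real)) (at_right 0)" by real_asymp
  show "\<forall>\<^sub>F t in at_right 0. t / 2 / sinh (t / 2) = sinhc_inv t"
    using eventually_at_right_less[of "0::real"] by eventually_elim (simp add: sinhc_inv_def)
qed

lemma sinhc_inv_ldiff_at_right_0: "(sinhc_inv_ldiff \<longlongrightarrow> 0) (at_right 0)"
  unfolding sinhc_inv_ldiff_def[abs_def] by real_asymp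

lemma sinhc_inv_at_top: "(sinhc_inv \<longlongrightarrow> 0) at_top"
proof (rule Lim_transform_eventually)
  show "((\<lambda>t. (t / 2) / sinh (t / 2)) \<longlongrightarrow> (0::real)) at_top" by real_asymp
  show "\<forall>\<^sub>F t in at_top. t / 2 / sinh (t / 2) = sinhc_inv t"
    using eventually_gt_at_top[of "0::real"] by eventually_elim (simp add: sinhc_inv_def)
qed

section \<open>The kernel of the Laplace representation\<close>

definition char_defect :: "nat \<Rightarrow> real \<Rightarrow> real" where
  "char_defect l t = (1 - sinhc_inv t ^ l) / t"

lemma borel_measurable_char_defect [measurable]: "char_defect l \<in> borel_measurable borel"
  unfolding char_defect_def by measurable

text \<open>Bernoulli's inequality and the linear lower bound on \<open>sinhc_inv\<close>. The
  factor \<open>t ^ 0\<close> fits the bound to the form \<open>B * t ^ k\<close> of the Laplace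
  lemmas.\<close>

lemma abs_char_defect_le:
  assumes "t > 0"
  shows "\<bar>char_defect l t\<bar> \<le> real l / 2 * t ^ 0"
proof -
  have "1 + real l * (sinhc_inv t - 1) \<le> (1 + (sinhc_inv t - 1)) ^ l"
    using sinhc_inv_bounds[of t] by (intro Bernoulli_inequality) auto
  then have "1 - sinhc_inv t ^ l \<le> real l * (1 - sinhc_inv t)"
    by (simp add: algebra_simps)
  also have "\<dots> \<le> real l * (t / 2)"
    using sinhc_inv_bounds[of t] assms by (intro mult_left_mono) auto
  finally have "1 - sinhc_inv t ^ l \<le> real l / 2 * t" by simp
  moreover have "sinhc_inv t ^ l \<le> 1"
    using sinhc_inv_bounds[of t] by (simp add: power_le_one)
  ultimately show ?thesis using assms by (simp add: char_defect_def field_simps)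
qed

text \<open>Each derivative in \<open>w\<close> multiplies the kernel by \<open>- t\<close> and
  raises the exponent of its bound by one, so \<open>k\<close> is 0, 1, 2. The nested signs are kept
  as the derivative rule produces them.\<close>

lemma has_bochner_integral_laplace_char_defect:
  assumes "w > 0"
  shows "has_bochner_integral lborel (\<lambda>t. indicator {0<..} t *\<^sub>R (char_defect l t * exp (- w * t))) (laplace (char_defect l) w)"
    and "has_bochner_integral lborel (\<lambda>t. indicator {0<..} t *\<^sub>R (- (t * char_defect l t) * exp (- w * t))) (laplace (\<lambda>t. - (t * char_defect l t)) w)"
    and "has_bochner_integral lborel (\<lambda>t. indicator {0<..} t *\<^sub>R (- (t * - (t * char_defect l t)) * exp (- w * t))) (laplace (\<lambda>t. - (t * - (t * char_defect l t))) w)"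
    and "(laplace (char_defect l) has_real_derivative laplace (\<lambda>t. - (t * char_defect l t)) w) (at w)"
    and "(laplace (\<lambda>t. - (t * char_defect l t)) has_real_derivative laplace (\<lambda>t. - (t * - (t * char_defect l t))) w) (at w)"
proof -
  have *: "\<bar>- (t * char_defect l t)\<bar> \<le> real l / 2 * t ^ 1" "\<bar>- (t * - (t * char_defect l t))\<bar> \<le> real l / 2 * t ^ 2" if "t > 0" for t
  proof -
    have "t * \<bar>char_defect l t\<bar> \<le> t * (real l / 2)"
      using abs_char_defect_le[OF that, of l] that by (intro mult_left_mono) auto
    moreover from this have "t * (t * \<bar>char_defect l t\<bar>) \<le> t * (t * (real l / 2))"
      using that by (intro mult_left_mono) auto
    ultimately show "\<bar>- (t * char_defect l t)\<bar> \<le> real l / 2 * t ^ 1" "\<bar>- (t * - (t * char_defect l t))\<bar> \<le> real l / 2 * t ^ 2"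
      using that by (auto simp: abs_mult power2_eq_square mult_ac)
  qed
  show "has_bochner_integral lborel (\<lambda>t. indicator {0<..} t *\<^sub>R (char_defect l t * exp (- w * t))) (laplace (char_defect l) w)"
    by (rule has_bochner_integral_laplace[OF _ abs_char_defect_le assms]) auto
  show "has_bochner_integral lborel (\<lambda>t. indicator {0<..} t *\<^sub>R (- (t * char_defect l t) * exp (- w * t))) (laplace (\<lambda>t. - (t * char_defect l t)) w)"
    by (rule has_bochner_integral_laplace[OF _ *(1) assms]) auto
  show "has_bochner_integral lborel (\<lambda>t. indicator {0<..} t *\<^sub>R (- (t * - (t * char_defect l t)) * exp (- w * t))) (laplace (\<lambda>t. - (t * - (t * char_defect l t))) w)"
    by (rule has_bochner_integral_laplace[OF _ *(2) assms]) auto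
  show "(laplace (char_defect l) has_real_derivative laplace (\<lambda>t. - (t * char_defect l t)) w) (at w)"
    by (rule laplace_char_defectas_derivative[OF _ abs_char_defect_le assms]) auto
  show "(laplace (\<lambda>t. - (t * char_defect l t)) has_real_derivative laplace (\<lambda>t. - (t * - (t * char_defect l t))) w) (at w)"
    by (rule laplace_char_defectas_derivative[OF _ *(1) assms]) auto
qed

section \<open>The recurrence between Laplace transforms\<close>

text \<open>Since \<open>(1 / sinh\<^sup>l)'' = l\<^sup>2 / sinh\<^sup>l + l (l + 1) / sinh\<^sup>l\<^sup>+\<^sup>2\<close>, the characteristic function
  \<open>\<phi>\<close> of \<open>rho l\<close> satisfies \<open>l (l + 1) \<phi>\<^bsub>l+2\<^esub> = t\<^sup>2 \<phi>'' - 2 l t \<phi>' + l (l + 1) \<phi> - l\<^sup>2 t\<^sup>2 / 4 \<phi>\<close>;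
  the recurrence is the Laplace transform of this equation.\<close>

lemma laplace_char_defect_recurrence:
  assumes "l \<ge> 1" and "w > 0"
  shows "real l * (real l + 1) * laplace (char_defect (l + 2)) w =
    (w ^ 2 - (real l) ^ 2 / 4) * laplace (\<lambda>t. - (t * - (t * char_defect l t))) w
    + 2 * (real l + 1) * w * laplace (\<lambda>t. - (t * char_defect l t)) w
    + real l * (real l + 1) * laplace (char_defect l) w + (real l) ^ 2 / (4 * w ^ 2)"
proof -
  let ?p = sinhc_inv
  let ?L = "real l"
  \<comment> \<open>With \<open>g = 1 - \<phi>\<close> for \<open>\<phi>(t) = sinhc_inv t ^ l\<close>, this is \<open>exp (- w t) * ((t g)' + w t g - 2 (l + 1) g)\<close>:
    the boundary term of integrating \<open>((t g)'' - 2 (l + 1) g') exp (- w t)\<close> by parts. Its derivative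
    is the combination of integrands in the claim.\<close>
  define G where "G = (\<lambda>t. exp (- w * t) * (1 - ?p t ^ l - ?L * ?p t ^ l * sinhc_inv_ldiff t + w * t * (1 - ?p t ^ l)
      - 2 * (?L + 1) * (1 - ?p t ^ l)))"
  define H where "H = (\<lambda>t. exp (- w * t) * (?L * (?L + 1) * (1 - ?p t ^ l * ?p t ^ 2) / t - w ^ 2 * t * (1 - ?p t ^ l)
      + ?L ^ 2 / 4 * t * (1 - ?p t ^ l) + 2 * (?L + 1) * w * (1 - ?p t ^ l)
      - ?L * (?L + 1) * (1 - ?p t ^ l) / t - ?L ^ 2 / 4 * t))"
  have DG: "(G has_real_derivative H t) (at t)" if "t > 0" for t
  proof -
    have Dphi: "((\<lambda>t. ?p t ^ l) has_real_derivative ?L * ?p t ^ l * sinhc_inv_ldiff t / t) (at t)"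
    proof -
      have "((\<lambda>t. ?p t ^ l) has_real_derivative ?L * (?p t * sinhc_inv_ldiff t / t) * ?p t ^ (l - 1)) (at t)"
        using DERIV_sinhc_inv[OF that] by (auto intro!: derivative_eq_intros)
      also have "?L * (?p t * sinhc_inv_ldiff t / t) * ?p t ^ (l - 1) = ?L * (?p t * ?p t ^ (l - 1)) * sinhc_inv_ldiff t / t"
        by simp
      also have "?p t * ?p t ^ (l - 1) = ?p t ^ l"
        using assms(1) by (cases l) auto
      finally show ?thesis .
    qed
    define \<phi> e where "\<phi> = ?p t ^ l" and "e = sinhc_inv_ldiff t"
    have "(G has_real_derivative
        exp (- w * t) * (- w) * (1 - \<phi> - ?L * \<phi> * e + w * t * (1 - \<phi>) - 2 * (?L + 1) * (1 - \<phi>))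
      + exp (- w * t) * (- (?L * \<phi> * e / t) - (?L * (?L * \<phi> * e / t) * e + ?L * \<phi> * (- (e * (1 - e)) / t - t / 4))
         + (w * (1 - \<phi>) - w * t * (?L * \<phi> * e / t)) + 2 * (?L + 1) * (?L * \<phi> * e / t))) (at t)"
      unfolding G_def \<phi>_def e_def
      by (rule derivative_eq_intros Dphi DERIV_sinhc_inv_ldiff[OF that] refl | (simp; fail))+
         (use that in \<open>simp add: field_simps\<close>)
    also have "exp (- w * t) * (- w) * (1 - \<phi> - ?L * \<phi> * e + w * t * (1 - \<phi>) - 2 * (?L + 1) * (1 - \<phi>))
      + exp (- w * t) * (- (?L * \<phi> * e / t) - (?L * (?L * \<phi> * e / t) * e + ?L * \<phi> * (- (e * (1 - e)) / t - t / 4))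
         + (w * (1 - \<phi>) - w * t * (?L * \<phi> * e / t)) + 2 * (?L + 1) * (?L * \<phi> * e / t)) 
      = exp (- w * t) * (?L * (?L + 1) * (1 - \<phi> * ((1 - e) ^ 2 - t ^ 2 / 4)) / t - w ^ 2 * t * (1 - \<phi>)
      + ?L ^ 2 / 4 * t * (1 - \<phi>) + 2 * (?L + 1) * w * (1 - \<phi>)
      - ?L * (?L + 1) * (1 - \<phi>) / t - ?L ^ 2 / 4 * t)"
    proof -
      \<comment> \<open>With \<open>exp (- w * t)\<close> divided out and
        \<open>sinhc_inv t ^ 2\<close> expressed through \<open>e\<close>, a rational identity in
        \<open>\<phi>\<close>, \<open>e\<close>, \<open>w\<close>, \<open>t\<close> remains.\<close>
      have "- w * (1 - \<phi> - ?L * \<phi> * e + w * t * (1 - \<phi>) - 2 * (?L + 1) * (1 - \<phi>))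
      + (- (?L * \<phi> * e / t) - (?L * (?L * \<phi> * e / t) * e + ?L * \<phi> * (- (e * (1 - e)) / t - t / 4))
         + (w * (1 - \<phi>) - w * t * (?L * \<phi> * e / t)) + 2 * (?L + 1) * (?L * \<phi> * e / t)) 
      = ?L * (?L + 1) * (1 - \<phi> * ((1 - e) ^ 2 - t ^ 2 / 4)) / t - w ^ 2 * t * (1 - \<phi>)
      + ?L ^ 2 / 4 * t * (1 - \<phi>) + 2 * (?L + 1) * w * (1 - \<phi>)
      - ?L * (?L + 1) * (1 - \<phi>) / t - ?L ^ 2 / 4 * t"
        using that by (simp add: divide_simps) (simp add: algebra_simps power2_eq_square)
      then show ?thesis
        by (simp only: mult.assoc distrib_left[symmetric])
    qed
    also have "\<dots> = H t"
      unfolding H_def \<phi>_def e_def sinhc_inv_square[OF that] ..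
    finally show ?thesis .
  qed
  have CH: "isCont H t" if "t > 0" for t
    unfolding H_def using that by (intro continuous_intros DERIV_isCont[OF DERIV_sinhc_inv]) auto
  \<comment> \<open>The last summand is the transform of \<open>t\<close>: it arises because the
    kernel involves \<open>1 - \<phi>\<close> while the differential equation concerns
    \<open>\<phi>\<close>.\<close>
  have int: "has_bochner_integral lborel (\<lambda>t. indicator {0<..} t *\<^sub>R H t)
     (?L * (?L + 1) * laplace (char_defect (l + 2)) w
      - (w ^ 2 - ?L ^ 2 / 4) * laplace (\<lambda>t. - (t * - (t * char_defect l t))) w
      - 2 * (?L + 1) * w * laplace (\<lambda>t. - (t * char_defect l t)) w
      - ?L * (?L + 1) * laplace (char_defect l) w - ?L ^ 2 / 4 * (fact 1 / w ^ Suc 1))"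
    (is "has_bochner_integral _ _ ?I")
  proof -
    have "has_bochner_integral lborel (\<lambda>t. ?L * (?L + 1) * (indicator {0<..} t *\<^sub>R (char_defect (l + 2) t * exp (- w * t)))
      - (w ^ 2 - ?L ^ 2 / 4) * (indicator {0<..} t *\<^sub>R (- (t * - (t * char_defect l t)) * exp (- w * t)))
      - 2 * (?L + 1) * w * (indicator {0<..} t *\<^sub>R (- (t * char_defect l t) * exp (- w * t)))
      - ?L * (?L + 1) * (indicator {0<..} t *\<^sub>R (char_defect l t * exp (- w * t))) 
      - ?L ^ 2 / 4 * (indicator {0<..} t *\<^sub>R (t ^ 1 * exp (- w * t)))) ?I"
      by (intro has_bochner_integral_diff has_bochner_integral_mult_right has_bochner_integral_laplace_char_defect
          has_bochner_integral_laplace_power assms)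
    also have "(\<lambda>t. ?L * (?L + 1) * (indicator {0<..} t *\<^sub>R (char_defect (l + 2) t * exp (- w * t)))
      - (w ^ 2 - ?L ^ 2 / 4) * (indicator {0<..} t *\<^sub>R (- (t * - (t * char_defect l t)) * exp (- w * t)))
      - 2 * (?L + 1) * w * (indicator {0<..} t *\<^sub>R (- (t * char_defect l t) * exp (- w * t)))
      - ?L * (?L + 1) * (indicator {0<..} t *\<^sub>R (char_defect l t * exp (- w * t))) 
      - ?L ^ 2 / 4 * (indicator {0<..} t *\<^sub>R (t ^ 1 * exp (- w * t)))) = (\<lambda>t. indicator {0<..} t *\<^sub>R H t)"
    proof
      fix t :: real
      show "?L * (?L + 1) * (indicator {0<..} t *\<^sub>R (char_defect (l + 2) t * exp (- w * t)))
      - (w ^ 2 - ?L ^ 2 / 4) * (indicator {0<..} t *\<^sub>R (- (t * - (t * char_defect l t)) * exp (- w * t)))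
      - 2 * (?L + 1) * w * (indicator {0<..} t *\<^sub>R (- (t * char_defect l t) * exp (- w * t)))
      - ?L * (?L + 1) * (indicator {0<..} t *\<^sub>R (char_defect l t * exp (- w * t))) 
      - ?L ^ 2 / 4 * (indicator {0<..} t *\<^sub>R (t ^ 1 * exp (- w * t))) = indicator {0<..} t *\<^sub>R H t"
      proof (cases "t > 0")
        case True
        define \<phi> q e where "\<phi> = ?p t ^ l" and "q = ?p t ^ 2" and "e = exp (- w * t)"
        have defect: "char_defect (l + 2) t = (1 - \<phi> * q) / t" "char_defect l t = (1 - \<phi>) / t"
          by (simp_all add: char_defect_def \<phi>_def q_def power_add power2_eq_square)
        show ?thesis
          using True unfolding defect H_def \<phi>_def[symmetric] q_def[symmetric] e_def[symmetric]
          by (simp add: divide_simps) (simp add: algebra_simps power2_eq_square)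
      qed simp
    qed
    finally show ?thesis .
  qed
  have G0: "(G \<longlongrightarrow> 0) (at_right 0)"
  proof -
    have "(G \<longlongrightarrow> exp (- w * 0) * (1 - 1 ^ l - ?L * 1 ^ l * 0 + w * 0 * (1 - 1 ^ l) - 2 * (?L + 1) * (1 - 1 ^ l))) (at_right 0)"
      unfolding G_def by (intro tendsto_intros sinhc_inv_at_right_0 sinhc_inv_ldiff_at_right_0)
    then show ?thesis by simp
  qed
  have Gtop: "(G \<longlongrightarrow> 0) at_top"
  proof -
    have a: "((\<lambda>t. exp (- w * t)) \<longlongrightarrow> 0) at_top" "((\<lambda>t. t * exp (- w * t)) \<longlongrightarrow> 0) at_top"
      using assms(2) by real_asymp+
    \<comment> \<open>\<open>sinhc_inv_ldiff\<close> is unbounded at infinity, so it is paired with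
      the exponential before taking limits; likewise for the factor \<open>t\<close>.\<close>
    have b: "((\<lambda>t. exp (- w * t) * sinhc_inv_ldiff t) \<longlongrightarrow> 0) at_top"
      unfolding sinhc_inv_ldiff_def using assms(2) by real_asymp
    have "((\<lambda>t. exp (- w * t) * (1 - ?p t ^ l) - ?L * ?p t ^ l * (exp (- w * t) * sinhc_inv_ldiff t)
       + w * (t * exp (- w * t)) * (1 - ?p t ^ l) - exp (- w * t) * (2 * (?L + 1) * (1 - ?p t ^ l)))
       \<longlongrightarrow> 0 * (1 - 0 ^ l) - ?L * 0 ^ l * 0 + w * 0 * (1 - 0 ^ l) - 0 * (2 * (?L + 1) * (1 - 0 ^ l))) at_top"
      by (intro tendsto_intros a b sinhc_inv_at_top)
    then show ?thesis by (simp add: G_def algebra_simps)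
  qed
  \<comment> \<open>Both boundary values of \<open>G\<close> vanish, so the integral of
    \<open>H\<close> is 0, which is the recurrence rearranged.\<close>
  have "(LBINT t=0..\<infinity>. H t) = 0 - 0"
  proof (rule interval_integral_FTC_integrable[where F = G])
    show "set_integrable lborel (einterval 0 \<infinity>) H"
      using int by (simp add: set_integrable_def has_bochner_integral_iff zero_ereal_def)
    show "((G \<circ> real_of_ereal) \<longlongrightarrow> 0) (at_right 0)"
      using G0 unfolding zero_ereal_def ereal_tendsto_simps .
    show "((G \<circ> real_of_ereal) \<longlongrightarrow> 0) (at_left \<infinity>)"
      using Gtop unfolding ereal_tendsto_simps .
  qed (use DG CH in \<open>auto simp flip: has_real_derivative_iff_has_vector_derivative\<close>)
  then have "?I = 0"
    using int by (simp add: interval_lebesgue_integral_0_infty set_lebesgue_integral_def has_bochner_integral_iff)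
  then show ?thesis by (simp add: power2_eq_square)
qed

section \<open>Transfer from Laplace transforms to \<open>y\<close>\<close>

lemma y_laplace:
  assumes "l \<ge> 1" and "x \<noteq> real l / 2"
  shows "y l x = laplace (char_defect l) \<bar>x - real l / 2\<bar>"
  using z_laplace[OF assms(1), of "\<bar>x - real l / 2\<bar>"] assms(2)
  by (simp add: y_def laplace_def char_defect_def)

theorem theorem4p7:
  fixes l :: nat and x :: real
  assumes "l \<ge> 1" and "x \<noteq> real l / 2"
  shows "real l * (real l + 1) * y (l + 2) (x + 1) =
           x * (x - real l) * deriv (deriv (y l)) x
         + 2 * (real l + 1) * (x - real l / 2) * deriv (y l) x
         + real l * (real l + 1) * y l x
         + (real l) ^ 2 / (4 * (x - real l / 2) ^ 2)"
proof -
  \<comment> \<open>With the sign fixed at \<open>x\<close>, the distance to \<open>l / 2\<close>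
    becomes the affine function \<open>w\<close> on the half-line \<open>S\<close> around
    \<open>x\<close>, so both sides of \<open>l / 2\<close> are treated at once.\<close>
  define s where "s = sgn (x - real l / 2)"
  define w where "w = (\<lambda>v. s * (v - real l / 2))"
  define S where "S = {v. w v > 0}"
  have s: "s * s = 1" using assms(2) by (auto simp: s_def sgn_if)
  have "x \<in> S" using assms(2) by (auto simp: S_def w_def s_def sgn_if)
  have "open S" unfolding S_def w_def by (intro open_Collect_less continuous_intros)
  have wS: "w v > 0" "v \<noteq> real l / 2" "\<bar>v - real l / 2\<bar> = w v" if "v \<in> S" for v
    using that s by (auto simp: S_def w_def s_def sgn_if split: if_splits)
  have y_eq: "laplace (char_defect l) (w v) = y l v" if "v \<in> S" for v
    using y_laplace[OF assms(1) wS(2)[OF that]] wS(3)[OF that] by simp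
  have Dw: "(w has_real_derivative s) (at v)" for v
    unfolding w_def by (auto intro!: derivative_eq_intros)
  \<comment> \<open>Proved on all of \<open>S\<close>, since the second derivative at
    \<open>x\<close> needs the first one on a neighbourhood.\<close>
  have D1: "deriv (y l) v = s * laplace (\<lambda>t. - (t * char_defect l t)) (w v)" if "v \<in> S" for v
  proof (rule DERIV_imp_deriv, rule has_field_derivative_transform_within_open[OF _ \<open>open S\<close> that y_eq])
    show "((\<lambda>v. laplace (char_defect l) (w v)) has_real_derivative s * laplace (\<lambda>t. - (t * char_defect l t)) (w v)) (at v)"
      using DERIV_chain2[OF has_bochner_integral_laplace_char_defect(4)[OF wS(1)[OF that]] Dw] by (simp add: mult.commute)
  qed
  have D2: "deriv (deriv (y l)) x = laplace (\<lambda>t. - (t * - (t * char_defect l t))) (w x)"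
  proof (rule DERIV_imp_deriv, rule has_field_derivative_transform_within_open[OF _ \<open>open S\<close> \<open>x \<in> S\<close> D1[symmetric]])
    have "((\<lambda>v. s * laplace (\<lambda>t. - (t * char_defect l t)) (w v)) has_real_derivative
       s * (laplace (\<lambda>t. - (t * - (t * char_defect l t))) (w x) * s)) (at x)"
      by (intro DERIV_cmult DERIV_chain2[OF has_bochner_integral_laplace_char_defect(5) Dw] wS \<open>x \<in> S\<close>)
    moreover have "s * (a * s) = a" for a :: real
      using s by (metis mult.assoc mult.commute mult_1_right)
    ultimately show "((\<lambda>v. s * laplace (\<lambda>t. - (t * char_defect l t)) (w v)) has_real_derivative
       laplace (\<lambda>t. - (t * - (t * char_defect l t))) (w x)) (at x)"
      by simp
  qed
  have shift: "\<bar>x + 1 - real (l + 2) / 2\<bar> = w x" "x + 1 \<noteq> real (l + 2) / 2"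
    using wS[OF \<open>x \<in> S\<close>] by (auto simp: field_simps)
  have y2: "y (l + 2) (x + 1) = laplace (char_defect (l + 2)) (w x)"
    using y_laplace[of "l + 2" "x + 1"] shift by simp
  have w2: "w x ^ 2 = (x - real l / 2) ^ 2"
    using s by (simp add: w_def power_mult_distrib power2_eq_square)
  \<comment> \<open>Completing the square turns the coefficient into the one of the Laplace
    recurrence.\<close>
  have coeff: "x * (x - real l) = w x ^ 2 - (real l) ^ 2 / 4"
    unfolding w2 by (simp add: power2_eq_square algebra_simps)
  have coeff': "2 * (real l + 1) * (x - real l / 2) * (s * a) = 2 * (real l + 1) * w x * a" for a
    by (simp add: w_def)
  show ?thesis
    unfolding y2 D2 D1[OF \<open>x \<in> S\<close>] y_eq[OF \<open>x \<in> S\<close>, symmetric] coeff coeff' w2[symmetric]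
    by (rule laplace_char_defect_recurrence[OF assms(1) wS(1)[OF \<open>x \<in> S\<close>]])
qed

end
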